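(* Let $\ell$ be an odd multiple of $3$. Let $S\subseteq D_{8\ell+6}\setminus\{e\}$ with $|S|=8\ell+4$, and let $x$ be the non-identity element of $D_{8\ell+6}$ not in $S$. If $x$ has order $(4\ell+3)/3$, then $D_{8\ell+6}$ has an $S$-sequencing.
   Context: $D_{2m}=\langle u,v : u^m=e=v^2,\ vu=u^{m-1}v\rangle$ is the dihedral group of order $2m$. For $S\subseteq G\setminus\{e\}$ with $|S|=k$, an $S$-sequencing of $G$ is an ordering $(g_1,\dots,g_k)$ of the elements of $S$ such that the partial products $h_0=e$, $h_i=g_1\cdots g_i$ ($1\le i\le k$) are pairwise distinct. *)

theory Defs
  imports "HOL-Algebra.Multiplicative_Group"
begin

text \<open>Dihedral group D_{2m} = <u,v | u^m = e = v^2, vu = u^(m-1) v>.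
  The element u^i v^b (0 <= i < m, b a boolean: b = True means the factor v is present)
  is represented by the pair (i, b).  Multiplication:
  (u^i v^a)(u^j v^b) = u^(i + (if a then -j else j)) v^(a xor b).\<close>

definition dihedral :: "nat \<Rightarrow> (nat \<times> bool) monoid" where
  "dihedral m =
     \<lparr> carrier = {0..<m} \<times> UNIV,
       mult = (\<lambda>(i, a) (j, b).
                 (if a then (i + (m - j)) mod m else (i + j) mod m, a \<noteq> b)),
       one = (0, False) \<rparr>"

definition partial_prod :: "('a, 'b) monoid_scheme \<Rightarrow> 'a list \<Rightarrow> nat \<Rightarrow> 'a" where
  "partial_prod G gs i = foldl (\<otimes>\<^bsub>G\<^esub>) \<one>\<^bsub>G\<^esub> (take i gs)"

definition S_sequencing :: "('a, 'b) monoid_scheme \<Rightarrow> 'a set \<Rightarrow> 'a list \<Rightarrow> bool" where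
  "S_sequencing G S gs \<longleftrightarrow>
     distinct gs \<and> set gs = S \<and>
     distinct (map (partial_prod G gs) [0..<Suc (length gs)])"

definition has_S_sequencing :: "('a, 'b) monoid_scheme \<Rightarrow> 'a set \<Rightarrow> bool" where
  "has_S_sequencing G S \<longleftrightarrow> (\<exists>gs. S_sequencing G S gs)"

end

theory Submission
  imports Defs "HOL-Computational_Algebra.Primes"
begin

text \<open>
  A sequencing is a walk through distinct group elements whose successive quotients
  $h_n^{-1} h_{n+1}$ are distinct.  Regard $D_{2m}$ as two copies (rows) of $\mathbb{Z}_m$.  An edge
  between the rows yields a reflection that depends only on the difference of the two positions,
  and an edge inside a row yields a rotation, with opposite signs in the two rows.  With
  $m = 4l + 3$, the walk zigzags through an interval of the first row, then alternates between the
  rows, which produces every reflection once, and finally zigzags through an interval of the second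
  row.  The zigzags produce complementary signs of the rotations by $1, \dots, 2l - 1$, only one
  sign of $2l$, and the two edges that join the three parts produce the rotations by
  $\pm (2l + 1)$.  So exactly the rotation by $-2l$ is omitted.  If $3$ divides $l$, it has order
  $m / 3$, and the automorphisms $u \mapsto u^r$ carry it to every element of that order.
\<close>

section \<open>Sequencings from walks\<close>

text \<open>The partial products telescope to \<open>inv (h 0) \<otimes> h n\<close>, a left
  translate of the walk, so they are distinct because its vertices are.\<close>

lemma (in group) S_sequencing_of_walk:
  assumes h: "h \<in> {..N} \<rightarrow> carrier G" and inj: "inj_on h {..N}"
    and inj_q: "inj_on (\<lambda>n. inv (h n) \<otimes> h (Suc n)) {..<N}"
  shows "S_sequencing G ((\<lambda>n. inv (h n) \<otimes> h (Suc n)) ` {..<N})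
           (map (\<lambda>n. inv (h n) \<otimes> h (Suc n)) [0..<N])"
proof -
  define q where "q = (\<lambda>n. inv (h n) \<otimes> h (Suc n))"
  have hc: "h n \<in> carrier G" if "n \<le> N" for n
    using h that by auto
  have pp: "partial_prod G (map q [0..<N]) n = inv (h 0) \<otimes> h n" if "n \<le> N" for n
    using that
  proof (induction n)
    case 0
    then show ?case using hc[of 0] by (simp add: partial_prod_def)
  next
    case (Suc n)
    have "partial_prod G (map q [0..<N]) (Suc n) = partial_prod G (map q [0..<N]) n \<otimes> q n"
      using Suc.prems by (simp add: partial_prod_def take_Suc_conv_app_nth)
    also have "\<dots> = inv (h 0) \<otimes> h (Suc n)"
      using Suc hc[of 0] hc[of n] hc[of "Suc n"]
      by (simp add: q_def m_assoc inv_solve_left' flip: m_assoc[of "h n"])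
    finally show ?case .
  qed
  have "inj_on (partial_prod G (map q [0..<N])) {..N}"
  proof (rule inj_onI)
    fix i j assume ij: "i \<in> {..N}" "j \<in> {..N}"
      and eq: "partial_prod G (map q [0..<N]) i = partial_prod G (map q [0..<N]) j"
    have "h i = h j"
      using eq ij hc[of 0] hc[of i] hc[of j] by (simp add: pp)
    then show "i = j" using inj ij by (auto dest: inj_onD)
  qed
  moreover have "{0..<Suc N} = {..N}" by auto
  moreover have "{0..<N} = {..<N}" by auto
  ultimately show ?thesis
    using inj_q unfolding q_def[symmetric]
    by (simp add: S_sequencing_def distinct_map del: upt_Suc)
qed

section \<open>The dihedral group\<close>

text \<open>Integer exponents allow negative positions and differences, without truncated
  subtraction.\<close>

definition dih :: "nat \<Rightarrow> int \<Rightarrow> bool \<Rightarrow> nat \<times> bool" where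
  "dih m z b = (nat (z mod int m), b)"

lemma dih_in_carrier: "m > 0 \<Longrightarrow> dih m z b \<in> carrier (dihedral m)"
  by (auto simp: dih_def dihedral_def nat_less_iff)

lemma carrier_dihedralE:
  assumes "x \<in> carrier (dihedral m)"
  obtains i b where "i < m" "x = dih m (int i) b"
  using assms that by (cases x) (auto simp: dih_def dihedral_def simp flip: zmod_int)

lemma one_dihedral: "m > 0 \<Longrightarrow> \<one>\<^bsub>dihedral m\<^esub> = dih m 0 False"
  by (simp add: dih_def dihedral_def)

lemma dih_eq_iff: "m > 0 \<Longrightarrow> dih m z a = dih m w b \<longleftrightarrow> z mod int m = w mod int m \<and> a = b"
  by (auto simp: dih_def eq_nat_nat_iff)

lemma dih_mult:
  assumes "m > 0"
  shows "dih m z a \<otimes>\<^bsub>dihedral m\<^esub> dih m w b = dih m (if a then z - w else z + w) (a \<noteq> b)"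
proof -
  have less: "nat (w mod int m) < m" using assms by (simp add: nat_less_iff)
  have "int ((nat (z mod int m) + (m - nat (w mod int m))) mod m) = (z - w) mod int m"
  proof -
    have "int ((nat (z mod int m) + (m - nat (w mod int m))) mod m) =
        (z mod int m + (int m - w mod int m)) mod int m"
      using less assms by (simp add: zmod_int of_nat_diff add_diff_eq)
    also have "\<dots> = (z mod int m - w mod int m + int m) mod int m"
      by (simp add: algebra_simps)
    also have "\<dots> = (z - w) mod int m"
      by (simp add: mod_diff_eq)
    finally show ?thesis .
  qed
  moreover have "int ((nat (z mod int m) + nat (w mod int m)) mod m) = (z + w) mod int m"
    using assms by (simp add: zmod_int mod_add_eq)
  ultimately have "(nat (z mod int m) + (m - nat (w mod int m))) mod m = nat ((z - w) mod int m)"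
    and "(nat (z mod int m) + nat (w mod int m)) mod m = nat ((z + w) mod int m)"
    by linarith+
  then show ?thesis by (simp add: dihedral_def dih_def)
qed

lemma group_dihedral:
  assumes "m > 0"
  shows "group (dihedral m)"
proof (rule groupI)
  fix x y assume "x \<in> carrier (dihedral m)" "y \<in> carrier (dihedral m)"
  then show "x \<otimes>\<^bsub>dihedral m\<^esub> y \<in> carrier (dihedral m)"
    using assms by (metis carrier_dihedralE dih_mult dih_in_carrier)
next
  show "\<one>\<^bsub>dihedral m\<^esub> \<in> carrier (dihedral m)"
    using assms by (simp add: one_dihedral dih_in_carrier)
next
  fix x y z
  assume "x \<in> carrier (dihedral m)" "y \<in> carrier (dihedral m)" "z \<in> carrier (dihedral m)"
  then show "x \<otimes>\<^bsub>dihedral m\<^esub> y \<otimes>\<^bsub>dihedral m\<^esub> z = x \<otimes>\<^bsub>dihedral m\<^esub> (y \<otimes>\<^bsub>dihedral m\<^esub> z)"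
    using assms by (elim carrier_dihedralE) (auto simp: dih_mult algebra_simps)
next
  fix x assume "x \<in> carrier (dihedral m)"
  then show "\<one>\<^bsub>dihedral m\<^esub> \<otimes>\<^bsub>dihedral m\<^esub> x = x"
    using assms by (elim carrier_dihedralE) (simp add: one_dihedral dih_mult)
next
  fix x assume "x \<in> carrier (dihedral m)"
  then obtain i b where x: "x = dih m (int i) b" by (elim carrier_dihedralE)
  have "dih m (if b then int i else - int i) b \<otimes>\<^bsub>dihedral m\<^esub> x = \<one>\<^bsub>dihedral m\<^esub>"
    using assms by (simp add: x one_dihedral dih_mult)
  then show "\<exists>y\<in>carrier (dihedral m). y \<otimes>\<^bsub>dihedral m\<^esub> x = \<one>\<^bsub>dihedral m\<^esub>"
    using assms dih_in_carrier by blast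
qed

lemma dih_inv_mult:
  assumes "m > 0"
  shows "inv\<^bsub>dihedral m\<^esub> (dih m z a) \<otimes>\<^bsub>dihedral m\<^esub> dih m w b =
           dih m (if a then z - w else w - z) (a \<noteq> b)"
proof -
  interpret group "dihedral m" using assms by (rule group_dihedral)
  have "inv\<^bsub>dihedral m\<^esub> (dih m z a) = dih m (if a then z else - z) a"
    by (rule inv_equality) (use assms in \<open>auto simp: dih_mult one_dihedral dih_in_carrier\<close>)
  then show ?thesis using assms by (simp add: dih_mult)
qed

lemma dih_pow_rotation:
  assumes "m > 0"
  shows "dih m z False [^]\<^bsub>dihedral m\<^esub> (n::nat) = dih m (int n * z) False"
proof -
  interpret group "dihedral m" using assms by (rule group_dihedral)
  show ?thesis
    using assms by (induction n) (simp_all add: one_dihedral dih_mult algebra_simps)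
qed

lemma card_carrier_dihedral: "card (carrier (dihedral m)) = 2 * m"
  by (simp add: dihedral_def card_cartesian_product)

text \<open>A multiple of \<open>m\<close> below \<open>m\<close> in absolute value is 0. With
  \<open>r\<close> a unit, distinctness in the group thus reduces to distinctness of
  integers.\<close>

lemma dih_scale_eqD:
  assumes "m > 0" "coprime r (int m)" "dih m (r * z) a = dih m (r * w) b"
    and "\<bar>z - w\<bar> < int m"
  shows "z = w"
proof -
  have "int m dvd r * (z - w)"
    using assms(1,3) by (simp add: dih_eq_iff mod_eq_dvd_iff algebra_simps)
  then have "int m dvd z - w"
    using assms(2) by (simp add: coprime_commute coprime_dvd_mult_right_iff)
  then show "z = w"
    using assms(4) dvd_imp_le_int by (metis abs_of_nat linorder_not_less right_minus_eq)
qed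

section \<open>The walk\<close>

text \<open>The zigzag 0, -1, 1, -2, 2, ... with successive differences -1, 2, -3, 4, ...\<close>

definition zig :: "nat \<Rightarrow> int" where
  "zig i = (if even i then int (i div 2) else - int (Suc i div 2))"

text \<open>
  The middle part visits the positions of both rows in the order \<open>swap 0, swap 1, \<dots>\<close>.  The
  differences there are, up to a shift, the sums \<open>swap i + swap i = 2 * swap i\<close> and
  \<open>swap i + swap (Suc i) = 2 * i + 1\<close>, hence a permutation of \<open>{0..4 * l + 2}\<close>, as they would be
  without the swaps.  The swaps move the endpoints one step inwards, which is what allows both
  joining edges to have length \<open>2 * l + 1\<close>.
\<close>
definition swap :: "nat \<Rightarrow> nat" where
  "swap i = (if even i then Suc i else i - 1)"

text \<open>The offsets make the parts tile the rows: \<open>-l..l\<close> and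
  \<open>-(3 * l + 2)..-(l + 1)\<close> fill the first, \<open>0..2 * l + 1\<close> and
  \<open>2 * l + 2..4 * l + 1\<close> leave one vertex of the second unvisited. The last zigzag is
  mirrored and run backwards.\<close>

definition pos :: "nat \<Rightarrow> nat \<Rightarrow> int" where
  "pos l n =
    (if n \<le> 2 * l then zig n
     else if n \<le> 6 * l + 4 then
       (if odd n then - int (swap ((n - (2 * l + 1)) div 2)) - int (l + 1)
        else int (swap ((n - (2 * l + 1)) div 2)))
     else int (3 * l + 1) - zig (8 * l + 4 - n))"

text \<open>The middle part begins at an odd index and ends at an even one, so both joining edges
  stay inside a row and give rotations.\<close>

definition row :: "nat \<Rightarrow> nat \<Rightarrow> bool" where
  "row l n \<longleftrightarrow> 6 * l + 4 < n \<or> 2 * l < n \<and> even n"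

definition step :: "nat \<Rightarrow> nat \<Rightarrow> int" where
  "step l n = (if row l n then pos l n - pos l (Suc n) else pos l (Suc n) - pos l n)"

section \<open>Arithmetic of the zigzag and of the swap\<close>

lemma zig_step: "zig (Suc i) - zig i = (if even i then - int (Suc i) else int (Suc i))"
  unfolding zig_def by (auto elim!: evenE oddE)

lemma zig_eq_iff: "zig i = zig j \<longleftrightarrow> i = j"
  unfolding zig_def
  by (cases "even i"; cases "even j") (auto elim!: evenE oddE, presburger+)

lemma zig_bounds: "2 * zig i \<le> int i" "- int i - 1 \<le> 2 * zig i"
  unfolding zig_def by (auto elim!: evenE oddE)

lemma swap_swap: "swap (swap i) = i"
  by (auto simp: swap_def dest: odd_pos)

lemma swap_eq_iff: "swap i = swap j \<longleftrightarrow> i = j"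
  by (metis swap_swap)

lemma swap_le: "i \<le> 2 * l + 1 \<Longrightarrow> swap i \<le> 2 * l + 1"
  unfolding swap_def by (auto elim!: evenE)

lemma eq_of_half_diff_eq:
  fixes c i j :: nat
  assumes "(i - c) div 2 = (j - c) div 2" "even i = even j" "c \<le> i" "c \<le> j"
  shows "i = j"
proof -
  have "even (i - c) = even (j - c)" using assms(2-4) by simp
  then have "i - c = j - c"
    using assms(1) by (metis even_two_times_div_two odd_two_times_div_two_succ)
  then show ?thesis using assms(3,4) by simp
qed

section \<open>Steps along the walk\<close>

lemma row_step: "row l n \<noteq> row l (Suc n) \<longleftrightarrow> 2 * l < n \<and> n < 6 * l + 4"
  unfolding row_def by presburger

text \<open>The joining steps \<open>-(2 * l + 2)\<close> and \<open>-(2 * l + 1)\<close> are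
  opposite modulo \<open>4 * l + 3\<close>. In the middle, odd \<open>n\<close> gives the even
  offsets from \<open>l + 1\<close> and even \<open>n\<close> the odd ones.\<close>

lemma step_eq:
  assumes "n < 8 * l + 4"
  shows "step l n =
    (if n < 2 * l then (if even n then - int (Suc n) else int (Suc n))
     else if n = 2 * l then - int (2 * l + 2)
     else if n < 6 * l + 4 then
       (if even n then int n - int l
        else int (l + 1) + 2 * int (swap ((n - (2 * l + 1)) div 2)))
     else if n = 6 * l + 4 then - int (2 * l + 1)
     else (if even n then int n - int (8 * l + 4) else int (8 * l + 4) - int n))"
proof -
  consider "n < 2 * l" | "n = 2 * l" | "2 * l < n" "n < 6 * l + 4" "even n"
    | "2 * l < n" "n < 6 * l + 4" "odd n" | "n = 6 * l + 4" | "6 * l + 4 < n"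
    by linarith
  then show ?thesis
  proof cases
    case 1
    then show ?thesis using zig_step[of n] by (simp add: step_def row_def pos_def)
  next
    case 2
    then show ?thesis by (simp add: step_def row_def pos_def zig_def swap_def)
  next
    case 3
    define a where "a = (n - (2 * l + 1)) div 2"
    have n: "n = 2 * l + 2 + 2 * a" using 3 unfolding a_def by (auto elim!: evenE)
    have "(n - (2 * l + 1)) div 2 = a" "(Suc n - (2 * l + 1)) div 2 = Suc a" using n by auto
    then show ?thesis using 3 n by (auto simp: step_def row_def pos_def swap_def of_nat_diff dest: odd_pos)
  next
    case 4
    define a where "a = (n - (2 * l + 1)) div 2"
    have n: "n = 2 * l + 1 + 2 * a" using 4 unfolding a_def by (auto elim!: oddE)
    have "(n - (2 * l + 1)) div 2 = a" "(Suc n - (2 * l + 1)) div 2 = a" using n by auto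
    then show ?thesis using 4 n by (auto simp: step_def row_def pos_def)
  next
    case 5
    then have "(n - (2 * l + 1)) div 2 = 2 * l + 1" by simp
    then show ?thesis using 5 assms by (cases l) (auto simp: step_def row_def pos_def zig_def swap_def)
  next
    case 6
    \<comment> \<open>Running backwards, mirroring and the sign of the second row are three sign
      changes, so the last zigzag gives the signs opposite to the first.\<close>
    define j where "j = 8 * l + 3 - n"
    have n: "8 * l + 4 - n = Suc j" "8 * l + 4 - Suc n = j" "8 * l + 4 = n + Suc j"
      using assms by (auto simp: j_def)
    have "even n \<longleftrightarrow> odd j" using n(3) by presburger
    moreover have "step l n = zig j - zig (Suc j)"
      using 6 by (simp add: step_def row_def pos_def n(1,2) del: diff_Suc_eq_diff_pred)
    ultimately show ?thesis using 6 n(3) zig_step[of j] by auto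
  qed
qed

section \<open>Distinctness of positions and of steps\<close>

text \<open>Each window holds \<open>4 * l + 3\<close> consecutive integers, so distinct positions
  in a row stay distinct modulo \<open>4 * l + 3\<close>.\<close>

lemma pos_bounds:
  assumes "n \<le> 8 * l + 4"
  shows "if row l n then 0 \<le> pos l n \<and> pos l n \<le> 4 * int l + 2
         else - 3 * int l - 2 \<le> pos l n \<and> pos l n \<le> int l"
proof -
  have "(n - (2 * l + 1)) div 2 \<le> 2 * l + 1" if "n \<le> 6 * l + 4"
    using that by linarith
  then show ?thesis
    using assms zig_bounds[of n] zig_bounds[of "8 * l + 4 - n"]
      swap_le[of "(n - (2 * l + 1)) div 2" l]
    unfolding pos_def row_def by (auto split: if_splits)
qed

lemma inj_pos: "inj_on (\<lambda>n. (pos l n, row l n)) {..8 * l + 4}"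
proof (rule inj_onI)
  fix i j assume ij: "i \<in> {..8 * l + 4}" "j \<in> {..8 * l + 4}"
    and eq: "(pos l i, row l i) = (pos l j, row l j)"
  \<comment> \<open>The three parts meet each row in disjoint intervals, so a common vertex forces a
    common part; inside a part \<open>zig\<close> or \<open>swap\<close> is injective.\<close>
  define region where "region = (\<lambda>n. (n \<le> 2 * l, n \<le> 6 * l + 4))"
  have middle: "(n - (2 * l + 1)) div 2 \<le> 2 * l + 1" if "n \<le> 6 * l + 4" for n
    using that by linarith
  have "region i = region j"
    using ij eq zig_bounds[of i] zig_bounds[of "8 * l + 4 - i"]
      zig_bounds[of j] zig_bounds[of "8 * l + 4 - j"]
      swap_le[of "(i - (2 * l + 1)) div 2" l] swap_le[of "(j - (2 * l + 1)) div 2" l]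
      middle[of i] middle[of j]
    unfolding pos_def row_def region_def by (simp split: if_splits)
  then consider "i \<le> 2 * l" "j \<le> 2 * l" | "2 * l < i" "i \<le> 6 * l + 4" "2 * l < j" "j \<le> 6 * l + 4"
    | "6 * l + 4 < i" "6 * l + 4 < j"
    unfolding region_def by auto
  then show "i = j"
  proof cases
    case 1
    then show ?thesis using eq by (simp add: pos_def zig_eq_iff)
  next
    case 2
    then have "even i = even j" using eq by (simp add: row_def)
    moreover have "(i - (2 * l + 1)) div 2 = (j - (2 * l + 1)) div 2"
      using 2 eq calculation by (simp add: pos_def swap_eq_iff split: if_splits)
    ultimately show ?thesis using 2 by (intro eq_of_half_diff_eq[of i "2 * l + 1" j]) auto
  next
    case 3
    then show ?thesis using ij eq by (auto simp: pos_def zig_eq_iff)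
  qed
qed

text \<open>Again both windows hold \<open>4 * l + 3\<close> integers; writing
  \<open>2 * l + 1\<close> as \<open>-(2 * l + 2)\<close> is what fits the rotations into theirs.
  The excluded values are the identity and the missing rotation.\<close>

lemma step_bounds:
  assumes "n < 8 * l + 4"
  shows "if row l n \<noteq> row l (Suc n) then int l + 1 \<le> step l n \<and> step l n \<le> 5 * int l + 3
         else - 2 * int l - 2 \<le> step l n \<and> step l n \<le> 2 * int l \<and> step l n \<noteq> 0 \<and> step l n \<noteq> - 2 * int l"
proof -
  have "(n - (2 * l + 1)) div 2 \<le> 2 * l + 1" if "n < 6 * l + 4"
    using that by linarith
  then show ?thesis
    using assms swap_le[of "(n - (2 * l + 1)) div 2" l]
    unfolding row_step step_eq[OF assms]
    by (auto split: if_splits)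
qed

lemma inj_step: "inj_on (\<lambda>n. (step l n, row l n \<noteq> row l (Suc n))) {..<8 * l + 4}"
proof (rule inj_onI)
  fix i j assume ij: "i \<in> {..<8 * l + 4}" "j \<in> {..<8 * l + 4}"
    and eq: "(step l i, row l i \<noteq> row l (Suc i)) = (step l j, row l j \<noteq> row l (Suc j))"
  have steps: "step l i = step l j"
    and refl: "(2 * l < i \<and> i < 6 * l + 4) = (2 * l < j \<and> j < 6 * l + 4)"
    using eq unfolding row_step by auto
  show "i = j"
  proof (cases "2 * l < i \<and> i < 6 * l + 4")
    case True
    then have j: "2 * l < j" "j < 6 * l + 4" using refl by auto
    \<comment> \<open>The parity of \<open>step l n + l\<close> separates the two families of
      reflections.\<close>
    have parity: "even i = even j"
    proof -
      have "even (step l n + int l) \<longleftrightarrow> even n" if "2 * l < n" "n < 6 * l + 4" for n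
        using that by (subst step_eq) auto
      from this[of i] this[of j] True j steps show ?thesis by simp
    qed
    show ?thesis
    proof (cases "even i")
      case True
      then show ?thesis
        using steps parity \<open>2 * l < i \<and> i < 6 * l + 4\<close> j by (simp add: step_eq)
    next
      case False
      then have "(i - (2 * l + 1)) div 2 = (j - (2 * l + 1)) div 2"
        using steps parity \<open>2 * l < i \<and> i < 6 * l + 4\<close> j by (simp add: step_eq swap_eq_iff)
      then show ?thesis
        using parity \<open>2 * l < i \<and> i < 6 * l + 4\<close> j
        by (intro eq_of_half_diff_eq[of i "2 * l + 1" j]) auto
    qed
  next
    case False
    have step: "step l n =
      (if n < 2 * l then (if even n then - int (Suc n) else int (Suc n))
       else if n = 2 * l then - int (2 * l + 2)
       else if n = 6 * l + 4 then - int (2 * l + 1)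
       else (if even n then int n - int (8 * l + 4) else int (8 * l + 4) - int n))"
      if "\<not> (2 * l < n \<and> n < 6 * l + 4)" "n < 8 * l + 4" for n
      using that by (subst step_eq) auto
    show ?thesis
      using steps ij False refl step[of i] step[of j]
      by (simp split: if_splits) presburger+
  qed
qed

text \<open>Multiplying all positions by a unit \<open>r\<close> has the effect of the automorphism
  sending u to u^r, and it scales the missing rotation likewise.\<close>

lemma has_S_sequencing_scaled:
  fixes l :: nat and r :: int
  defines "m \<equiv> 4 * l + 3"
  assumes l: "l > 0" and r: "coprime r (int m)"
  shows "has_S_sequencing (dihedral m)
           (carrier (dihedral m) - {\<one>\<^bsub>dihedral m\<^esub>, dih m (r * (- 2 * int l)) False})"
proof -
  have m: "m > 0" by (simp add: m_def)
  interpret group "dihedral m" using m by (rule group_dihedral)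
  define N where "N = 8 * l + 4"
  define h where "h = (\<lambda>n. dih m (r * pos l n) (row l n))"
  define q where "q = (\<lambda>n. inv\<^bsub>dihedral m\<^esub> (h n) \<otimes>\<^bsub>dihedral m\<^esub> h (Suc n))"
  have q_eq: "q n = dih m (r * step l n) (row l n \<noteq> row l (Suc n))" for n
    using m by (simp add: q_def h_def dih_inv_mult step_def right_diff_distrib)
  have dih_row: "a = b" if "dih m z a = dih m w b" for z w a b
    using that by (simp add: dih_def)
  have h_carrier: "h \<in> {..N} \<rightarrow> carrier (dihedral m)"
    using m by (simp add: h_def dih_in_carrier)
  have inj_h: "inj_on h {..N}"
  proof (rule inj_onI)
    fix i j assume ij: "i \<in> {..N}" "j \<in> {..N}" and eq: "h i = h j"
    have rows: "row l i = row l j" using eq dih_row by (simp add: h_def)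
    have "pos l i = pos l j"
      by (rule dih_scale_eqD[OF m r eq[unfolded h_def]])
        (use ij rows pos_bounds[of i l] pos_bounds[of j l] in \<open>auto simp: m_def N_def split: if_splits\<close>)
    then show "i = j" using inj_onD[OF inj_pos, of l i j] rows ij by (simp add: N_def)
  qed
  have inj_q: "inj_on q {..<N}"
  proof (rule inj_onI)
    fix i j assume ij: "i \<in> {..<N}" "j \<in> {..<N}" and eq: "q i = q j"
    have rows: "(row l i \<noteq> row l (Suc i)) = (row l j \<noteq> row l (Suc j))"
      using eq dih_row unfolding q_eq by blast
    have "step l i = step l j"
      by (rule dih_scale_eqD[OF m r eq[unfolded q_eq]])
        (use ij rows step_bounds[of i l] step_bounds[of j l] in \<open>auto simp: m_def N_def split: if_splits\<close>)
    then show "i = j" using inj_onD[OF inj_step, of l i j] rows ij by (simp add: N_def)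
  qed
  have q_ne: "q n \<noteq> dih m (r * z) False" if "n < N" "z \<in> {0, - 2 * int l}" for n z
  proof
    assume eq: "q n = dih m (r * z) False"
    then have rows: "\<not> (row l n \<noteq> row l (Suc n))"
      using dih_row unfolding q_eq by blast
    have "step l n = z"
      by (rule dih_scale_eqD[OF m r eq[unfolded q_eq]])
        (use that rows step_bounds[of n l] in \<open>auto simp: m_def N_def split: if_splits\<close>)
    then show False using that rows step_bounds[of n l] by (auto simp: N_def)
  qed
  let ?x = "dih m (r * (- 2 * int l)) False"
  have "q ` {..<N} \<subseteq> carrier (dihedral m) - {\<one>\<^bsub>dihedral m\<^esub>, ?x}"
    using q_ne[of _ 0] q_ne[of _ "- 2 * int l"] m
    by (auto simp: one_dihedral) (auto simp: q_eq dih_in_carrier)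
  \<comment> \<open>Counting replaces a surjectivity argument: the \<open>N = 2 * m - 2\<close>
    distinct quotients exhaust the set that contains them.\<close>
  moreover have "card (carrier (dihedral m) - {\<one>\<^bsub>dihedral m\<^esub>, ?x}) \<le> card (q ` {..<N})"
  proof -
    have "\<one>\<^bsub>dihedral m\<^esub> \<noteq> ?x"
    proof
      assume "\<one>\<^bsub>dihedral m\<^esub> = ?x"
      then have "dih m (r * 0) False = ?x" using m by (simp add: one_dihedral)
      from dih_scale_eqD[OF m r this] l show False by (simp add: m_def)
    qed
    then have "card {\<one>\<^bsub>dihedral m\<^esub>, ?x} = 2" by simp
    then have "card (carrier (dihedral m) - {\<one>\<^bsub>dihedral m\<^esub>, ?x}) = 2 * m - 2"
      using m by (subst card_Diff_subset) (auto simp: card_carrier_dihedral dih_in_carrier)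
    then show ?thesis using card_image[OF inj_q] by (simp add: m_def N_def)
  qed
  moreover have "finite (carrier (dihedral m))"
    by (simp add: dihedral_def)
  ultimately have "q ` {..<N} = carrier (dihedral m) - {\<one>\<^bsub>dihedral m\<^esub>, ?x}"
    by (intro card_seteq) auto
  then show ?thesis
    using S_sequencing_of_walk[OF h_carrier inj_h inj_q[unfolded q_def]]
    unfolding has_S_sequencing_def q_def by metis
qed

section \<open>Reduction to one missing element\<close>

text \<open>One of \<open>c\<close> and \<open>c + M\<close> works: if 3 divides \<open>c\<close>,
  it does not divide \<open>M\<close>, hence not \<open>c + M\<close>.\<close>

lemma coprime_lift_3:
  fixes c M :: int
  assumes "coprime c M"
  obtains r where "coprime r (3 * M)" "M dvd r - c"
proof (cases "3 dvd c")
  case True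
  then have "\<not> 3 dvd M" using assms not_coprimeI[of 3 c M] by auto
  then have "\<not> 3 dvd c + M" using True by (simp add: dvd_add_right_iff)
  then have "coprime (c + M) 3"
    using prime_imp_coprime[of 3 "c + M"] by (simp add: coprime_commute)
  moreover have "coprime (c + M) M"
    using assms by (simp only: coprime_iff_gcd_eq_1 gcd_add1)
  ultimately show ?thesis
    using that[of "c + M"] by simp
next
  case False
  then have "coprime c 3"
    using prime_imp_coprime[of 3 c] by (simp add: coprime_commute)
  then show ?thesis using assms that[of c] by simp
qed

theorem theorem5p9:
  fixes l :: nat and S :: "(nat \<times> bool) set" and x :: "nat \<times> bool"
  assumes "odd l" and "3 dvd l"
    and "S \<subseteq> carrier (dihedral (4 * l + 3)) - {\<one>\<^bsub>dihedral (4 * l + 3)\<^esub>}"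
    and "card S = 8 * l + 4"
    and "x \<in> carrier (dihedral (4 * l + 3)) - {\<one>\<^bsub>dihedral (4 * l + 3)\<^esub>}"
    and "x \<notin> S"
    and "group.ord (dihedral (4 * l + 3)) x = (4 * l + 3) div 3"
  shows "has_S_sequencing (dihedral (4 * l + 3)) S"
proof -
  define m where "m = 4 * l + 3"
  obtain n where l: "l = 3 * n" using assms(2) by (auto elim: dvdE)
  define M where "M = 4 * n + 1"
  have m: "m = 3 * M" "m > 0" by (simp_all add: m_def M_def l)
  have "n > 0" using assms(1) l by (cases n) auto
  interpret group "dihedral m" using m(2) by (rule group_dihedral)
  have x: "x \<in> carrier (dihedral m)" "x \<noteq> \<one>\<^bsub>dihedral m\<^esub>"
    using assms(5) by (simp_all add: m_def)
  have "ord x = M" using assms(7) m(1) by (simp add: m_def[symmetric])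
  then have pow_x: "x [^]\<^bsub>dihedral m\<^esub> k = \<one>\<^bsub>dihedral m\<^esub> \<longleftrightarrow> M dvd k" for k :: nat
    using pow_eq_id[OF x(1)] by simp
  obtain c b where c: "x = dih m (int c) b" using x(1) by (elim carrier_dihedralE)
  \<comment> \<open>A reflection squares to the identity, but \<open>M = 4 * n + 1\<close> exceeds
    2.\<close>
  have "\<not> b"
  proof
    assume b
    then have "x [^]\<^bsub>dihedral m\<^esub> (2::nat) = \<one>\<^bsub>dihedral m\<^esub>"
      using m(2) x(1) by (simp add: c numeral_2_eq_2 dih_mult one_dihedral)
    then have "M dvd 2" by (simp add: pow_x)
    then have "M \<le> 2" by (rule dvd_imp_le) simp
    then show False using \<open>n > 0\<close> by (simp add: M_def)
  qed
  then have dvd_iff: "m dvd k * c \<longleftrightarrow> M dvd k" for k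
    using pow_x[of k] m(2)
    by (simp add: c dih_pow_rotation one_dihedral dih_eq_iff flip: zmod_int of_nat_mult)
       (simp add: dvd_eq_mod_eq_0)
  have "3 dvd c" using dvd_iff[of M] m by (auto simp: mult.commute)
  then obtain d where d: "c = 3 * d" by (elim dvdE)
  have "coprime d M"
  proof -
    \<comment> \<open>For \<open>t = M / g\<close> the \<open>t\<close>-th power of \<open>x\<close>
      is already trivial, so the order \<open>M\<close> divides \<open>t\<close> and
      \<open>g = 1\<close>.\<close>
    define g where "g = gcd d M"
    obtain s t where st: "d = g * s" "M = g * t" unfolding g_def by (meson dvdE gcd_dvd1 gcd_dvd2)
    have "m dvd t * c" by (simp add: m d st)
    then have "M dvd t" by (simp add: dvd_iff)
    moreover have "M > 0" by (simp add: M_def)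
    ultimately have "g = 1" using st(2) dvd_antisym[of M t] by auto
    then show ?thesis by (simp add: g_def coprime_iff_gcd_eq_1)
  qed
  \<comment> \<open>The scaling factor must satisfy \<open>r * (- 2 * l) = c\<close> modulo
    \<open>m\<close>, that is \<open>2 * n * r = - d\<close> modulo \<open>M\<close>. As
    \<open>4 * n = -1\<close> there, \<open>r = 2 * d\<close> solves it; the lift makes
    \<open>r\<close> a unit modulo \<open>3 * M\<close>.\<close>
  moreover have "coprime 2 M" by (simp add: M_def)
  ultimately have "coprime (int (2 * d)) (int M)"
    unfolding coprime_int_iff by simp
  then have "coprime (2 * int d) (int M)" by simp
  then obtain r where r: "coprime r (3 * int M)" "int M dvd r - 2 * int d"
    by (rule coprime_lift_3)
  have "int M dvd 2 * int n * (r - 2 * int d) + int M * int d"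
    using r(2) by simp
  also have "2 * int n * (r - 2 * int d) + int M * int d = 2 * int n * r + int d"
    by (simp add: M_def algebra_simps)
  finally have "int M dvd 2 * int n * r + int d" .
  then have "3 * int M dvd 3 * (2 * int n * r + int d)" by (rule mult_dvd_mono[OF dvd_refl])
  moreover have "3 * (2 * int n * r + int d) = int c - r * (- 2 * int l)"
    by (simp add: d l)
  ultimately have "int m dvd int c - r * (- 2 * int l)" using m(1) by simp
  then have x_eq: "x = dih m (r * (- 2 * int l)) False"
    using m(2) \<open>\<not> b\<close> by (simp add: c dih_eq_iff mod_eq_dvd_iff)
  have "S = carrier (dihedral m) - {\<one>\<^bsub>dihedral m\<^esub>, x}"
  proof (rule card_subset_eq)
    show "finite (carrier (dihedral m) - {\<one>\<^bsub>dihedral m\<^esub>, x})" by (simp add: dihedral_def)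
    show "S \<subseteq> carrier (dihedral m) - {\<one>\<^bsub>dihedral m\<^esub>, x}"
      using assms(3,6) by (auto simp: m_def)
    show "card S = card (carrier (dihedral m) - {\<one>\<^bsub>dihedral m\<^esub>, x})"
      using assms(4) x one_closed by (subst card_Diff_subset) (auto simp: card_carrier_dihedral m_def)
  qed
  moreover have "coprime r (int (4 * l + 3))"
    using r(1) by (simp only: m_def[symmetric] m(1) of_nat_mult of_nat_numeral)
  moreover have "l > 0" using \<open>n > 0\<close> l by simp
  ultimately show ?thesis
    using has_S_sequencing_scaled[of l r] unfolding m_def x_eq[unfolded m_def] by simp
qed

end
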